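(* Let $\rho>1$. Let $(n_k)_{k\in\mathbb{N}}$ be a strictly increasing sequence of natural numbers and $\varepsilon:\mathbb{Z}^+\to(0,\infty)$ a function such that: - $\varepsilon(n)=1$ for $0\le n\le n_1$; - for each $k\ge2$, $\varepsilon(n)=\varepsilon(n_{k-1}+1)$ for all $n$ with $n_{k-1}+1<n\le n_k$, and $0<\left(\frac1{n_k}\right)^{1/n_k}(\rho+\varepsilon(n_{k-1}+1))-\rho$; - for each $k\ge1$, $0<\varepsilon(n_k+1)<\left(\frac1{n_k}\right)^{1/n_k}(\rho+\varepsilon(n_k))-\rho$ and $\varepsilon(n_k+1)<\min\{1/k,\varepsilon(n_k)\}$. Let $\omega$ be the weight on $\mathbb{Z}^+$ given by $\omega_n=(\rho+\varepsilon(n))^n$ $(n\in\mathbb{Z}^+)$. Then neither of the maximal ideals $M_1$ and $M_0$ of $\ell^1(\mathbb{Z}^+,\omega)$ is finitely-generated, even though both $0$ and $1$ correspond to interior points of the character space of $\ell^1(\mathbb{Z}^+,\omega)$.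
   Context: $\mathbb{Z}^+=\{0,1,2,\ldots\}$ (an additive semigroup) and $\mathbb{N}=\{1,2,\ldots\}$. A weight on $\mathbb{Z}^+$ is a function $\omega:\mathbb{Z}^+\to[1,\infty)$, written $n\mapsto\omega_n$, with $\omega_{m+n}\le\omega_m\omega_n$ and $\omega_0=1$. $\ell^1(\mathbb{Z}^+,\omega)$ is the set of $f:\mathbb{Z}^+\to\mathbb{C}$ with $\|f\|_\omega=\sum_n|f(n)|\omega_n<\infty$, a commutative unital Banach algebra under convolution; $\delta_n$ is the point mass at $n$. The character space of $\ell^1(\mathbb{Z}^+,\omega)$ is identified, via $\varphi\mapsto\varphi(\delta_1)$, with the disc $\{z\in\mathbb{C}:|z|\le\lim_{n\to\infty}\omega_n^{1/n}\}$; for the weight considered here the limit equals $\rho$. For $z$ in this disc, $M_z$ denotes the maximal ideal which is the kernel of the character corresponding to $z$, i.e. $M_z=\{f:\sum_n f(n)z^n=0\}$. "Interior point" means interior point of this disc as a subset of $\mathbb{C}$. An ideal $I$ of a commutative unital algebra $A$ is finitely-generated if there exist $n\in\mathbb{N}$ and $x_1,\ldots,x_n\in A$ with $I=Ax_1+\cdots+Ax_n$ (purely algebraically, no closure is taken). *)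

theory Defs
  imports "HOL-Analysis.Analysis" "HOL-Algebra.Ring"
begin

definition weight :: "(nat \<Rightarrow> real) \<Rightarrow> bool" where
  "weight \<omega> \<longleftrightarrow> (\<forall>n. 1 \<le> \<omega> n) \<and> (\<forall>m n. \<omega> (m + n) \<le> \<omega> m * \<omega> n) \<and> \<omega> 0 = 1"

definition delta :: "nat \<Rightarrow> nat \<Rightarrow> complex" where
  "delta n = (\<lambda>m. if m = n then 1 else 0)"

definition conv :: "(nat \<Rightarrow> complex) \<Rightarrow> (nat \<Rightarrow> complex) \<Rightarrow> nat \<Rightarrow> complex" where
  "conv f g = (\<lambda>n. \<Sum>k\<le>n. f k * g (n - k))"

text \<open>The ring underlying the weighted convolution algebra. The norm and the scalar
  multiplication, which is pointwise, are not part of the record.\<close>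

definition ell1 :: "(nat \<Rightarrow> real) \<Rightarrow> (nat \<Rightarrow> complex) ring" where
  "ell1 \<omega> = \<lparr>carrier = {f. summable (\<lambda>n. cmod (f n) * \<omega> n)},
             mult = conv, one = delta 0,
             zero = (\<lambda>n. 0), add = (\<lambda>f g n. f n + g n)\<rparr>"

text \<open>Characters are the nonzero algebra homomorphisms to the complex numbers; continuity is
  not required. They are taken to be \<^const>\<open>extensional\<close> so that a character is determined by
  its values on the algebra.\<close>

definition character_space :: "(nat \<Rightarrow> real) \<Rightarrow> ((nat \<Rightarrow> complex) \<Rightarrow> complex) set" where
  "character_space \<omega> = {\<phi> \<in> extensional (carrier (ell1 \<omega>)).
     (\<forall>f \<in> carrier (ell1 \<omega>). \<forall>g \<in> carrier (ell1 \<omega>). \<phi> (f \<oplus>\<^bsub>ell1 \<omega>\<^esub> g) = \<phi> f + \<phi> g) \<and>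
     (\<forall>c. \<forall>f \<in> carrier (ell1 \<omega>). \<phi> (\<lambda>n. c * f n) = c * \<phi> f) \<and>
     (\<forall>f \<in> carrier (ell1 \<omega>). \<forall>g \<in> carrier (ell1 \<omega>). \<phi> (f \<otimes>\<^bsub>ell1 \<omega>\<^esub> g) = \<phi> f * \<phi> g) \<and>
     (\<exists>f \<in> carrier (ell1 \<omega>). \<phi> f \<noteq> 0)}"

text \<open>The character space as a subset of the complex plane, under the identification of a
  character with its value at \<^term>\<open>delta 1\<close>.\<close>

definition character_disc :: "(nat \<Rightarrow> real) \<Rightarrow> complex set" where
  "character_disc \<omega> = (\<lambda>\<phi>. \<phi> (delta 1)) ` character_space \<omega>"

text \<open>The kernel of the character corresponding to \<open>z\<close>. Only meaningful for \<open>z\<close> in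
  \<^term>\<open>character_disc \<omega>\<close>, where the series converges on the whole algebra.\<close>

definition max_ideal_at :: "(nat \<Rightarrow> real) \<Rightarrow> complex \<Rightarrow> (nat \<Rightarrow> complex) set" where
  "max_ideal_at \<omega> z = {f \<in> carrier (ell1 \<omega>). (\<Sum>n. f n * z ^ n) = 0}"

definition finitely_generated :: "('a, 'b) ring_scheme \<Rightarrow> 'a set \<Rightarrow> bool" where
  "finitely_generated R I \<longleftrightarrow>
     (\<exists>n::nat. n \<ge> 1 \<and> (\<exists>x \<in> {1..n} \<rightarrow> carrier R.
        I = {(\<Oplus>\<^bsub>R\<^esub>i\<in>{1..n}. a i \<otimes>\<^bsub>R\<^esub> x i) | a. a \<in> {1..n} \<rightarrow> carrier R}))"

lemma conv_eq_fps_mult: "conv f g = fps_nth (Abs_fps f * Abs_fps g)"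
  by (auto simp: conv_def fps_mult_nth atLeast0AtMost)

lemma conv_in_ell1:
  assumes w: "weight \<omega>"
    and f: "f \<in> carrier (ell1 \<omega>)" and g: "g \<in> carrier (ell1 \<omega>)"
  shows "conv f g \<in> carrier (ell1 \<omega>)"
proof -
  have p: "0 \<le> \<omega> n" for n
    using w order_trans[of 0 1 "\<omega> n"] by (simp add: weight_def)
  have s: "summable (\<lambda>n. \<Sum>k\<le>n. (cmod (f k) * \<omega> k) * (cmod (g (n - k)) * \<omega> (n - k)))"
    using f g p by (intro summable_Cauchy_product) (simp_all add: ell1_def)
  have "cmod (conv f g n) * \<omega> n
      \<le> (\<Sum>k\<le>n. (cmod (f k) * \<omega> k) * (cmod (g (n - k)) * \<omega> (n - k)))" for n
  proof -
    have "cmod (conv f g n) * \<omega> n \<le> (\<Sum>k\<le>n. cmod (f k) * cmod (g (n - k))) * \<omega> n"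
      unfolding conv_def by (intro mult_right_mono p sum_norm_le) (simp add: norm_mult)
    also have "\<dots> = (\<Sum>k\<le>n. cmod (f k) * cmod (g (n - k)) * \<omega> n)"
      by (rule sum_distrib_right)
    also have "\<dots> \<le> (\<Sum>k\<le>n. cmod (f k) * cmod (g (n - k)) * (\<omega> k * \<omega> (n - k)))"
    proof (intro sum_mono mult_left_mono)
      fix k assume "k \<in> {..n}"
      then show "\<omega> n \<le> \<omega> k * \<omega> (n - k)"
        using w unfolding weight_def by (metis atMost_iff le_add_diff_inverse)
    qed simp
    finally show ?thesis by (simp add: mult_ac)
  qed
  then have "summable (\<lambda>n. cmod (conv f g n) * \<omega> n)"
    by (intro summable_comparison_test'[OF s, of 0]) (simp add: p abs_mult)
  then show ?thesis by (simp add: ell1_def)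
qed

lemma delta_in_ell1: "delta m \<in> carrier (ell1 \<omega>)"
proof -
  have "summable (\<lambda>n. cmod (delta m n) * \<omega> n)"
    by (rule summable_finite[of "{m}"]) (auto simp: delta_def)
  then show ?thesis by (simp add: ell1_def)
qed

lemma cring_ell1:
  assumes w: "weight \<omega>"
  shows "cring (ell1 \<omega>)"
proof (rule cringI)
  have p: "0 \<le> \<omega> n" for n
    using w order_trans[of 0 1 "\<omega> n"] by (simp add: weight_def)
  have add: "(\<lambda>n. f n + g n) \<in> carrier (ell1 \<omega>)"
    if "f \<in> carrier (ell1 \<omega>)" "g \<in> carrier (ell1 \<omega>)" for f g
  proof -
    have s: "summable (\<lambda>n. cmod (f n) * \<omega> n + cmod (g n) * \<omega> n)"
      using that by (intro summable_add) (simp_all add: ell1_def)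
    have "summable (\<lambda>n. cmod (f n + g n) * \<omega> n)"
      by (intro summable_comparison_test'[OF s, of 0])
        (simp add: p abs_mult mult_right_mono norm_triangle_ineq flip: distrib_right)
    then show ?thesis by (simp add: ell1_def)
  qed
  show "abelian_group (ell1 \<omega>)"
  proof (rule abelian_groupI)
    fix f assume "f \<in> carrier (ell1 \<omega>)"
    then show "\<exists>g \<in> carrier (ell1 \<omega>). g \<oplus>\<^bsub>ell1 \<omega>\<^esub> f = \<zero>\<^bsub>ell1 \<omega>\<^esub>"
      by (intro bexI[of _ "\<lambda>n. - f n"]) (simp_all add: ell1_def)
  next
    fix f g assume "f \<in> carrier (ell1 \<omega>)" "g \<in> carrier (ell1 \<omega>)"
    then show "f \<oplus>\<^bsub>ell1 \<omega>\<^esub> g \<in> carrier (ell1 \<omega>)"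
      using add[of f g] by (simp add: ell1_def)
  qed (simp_all add: ell1_def add_ac)
  show "Group.comm_monoid (ell1 \<omega>)"
  proof (rule comm_monoidI)
    show "\<one>\<^bsub>ell1 \<omega>\<^esub> \<in> carrier (ell1 \<omega>)"
      using delta_in_ell1[of 0 \<omega>] by (simp add: ell1_def)
    fix f g h assume *: "f \<in> carrier (ell1 \<omega>)" "g \<in> carrier (ell1 \<omega>)"
    then show "f \<otimes>\<^bsub>ell1 \<omega>\<^esub> g \<in> carrier (ell1 \<omega>)"
      using conv_in_ell1[OF w *] by (simp add: ell1_def)
    show "f \<otimes>\<^bsub>ell1 \<omega>\<^esub> g = g \<otimes>\<^bsub>ell1 \<omega>\<^esub> f"
      by (simp add: ell1_def conv_eq_fps_mult mult.commute)
    show "(f \<otimes>\<^bsub>ell1 \<omega>\<^esub> g) \<otimes>\<^bsub>ell1 \<omega>\<^esub> h = f \<otimes>\<^bsub>ell1 \<omega>\<^esub> (g \<otimes>\<^bsub>ell1 \<omega>\<^esub> h)"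
      by (simp add: ell1_def conv_eq_fps_mult fps_nth_inverse mult.assoc)
  next
    fix f assume "f \<in> carrier (ell1 \<omega>)"
    have "Abs_fps (delta 0) = 1" by (auto simp: fps_eq_iff delta_def)
    then show "\<one>\<^bsub>ell1 \<omega>\<^esub> \<otimes>\<^bsub>ell1 \<omega>\<^esub> f = f"
      by (simp add: ell1_def conv_eq_fps_mult fun_eq_iff)
  qed
  fix f g h :: "nat \<Rightarrow> complex"
  show "(f \<oplus>\<^bsub>ell1 \<omega>\<^esub> g) \<otimes>\<^bsub>ell1 \<omega>\<^esub> h = f \<otimes>\<^bsub>ell1 \<omega>\<^esub> h \<oplus>\<^bsub>ell1 \<omega>\<^esub> g \<otimes>\<^bsub>ell1 \<omega>\<^esub> h"
    by (simp add: ell1_def conv_def distrib_right sum.distrib)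
qed

text \<open>Evaluation at \<open>z\<close> is a character, with kernel \<^term>\<open>max_ideal_at \<omega> z\<close>, when
  \<open>z\<close> is dominated by the weight. By submultiplicativity (Fekete) the domination condition
  describes the disc with radius the limit of the \<open>n\<close>-th roots of the weights.\<close>

lemma evaluation_character:
  assumes w: "weight \<omega>" and z: "\<And>n. cmod z ^ n \<le> \<omega> n"
  defines "\<phi> \<equiv> restrict (\<lambda>f. \<Sum>n. f n * z ^ n) (carrier (ell1 \<omega>))"
  shows "\<phi> \<in> character_space \<omega>" and "\<phi> (delta 1) = z"
    and "max_ideal_at \<omega> z = {f \<in> carrier (ell1 \<omega>). \<phi> f = 0}"
proof -
  have ns: "summable (\<lambda>n. cmod (f n * z ^ n))" if "f \<in> carrier (ell1 \<omega>)" for f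
  proof -
    have s: "summable (\<lambda>n. cmod (f n) * \<omega> n)" using that by (simp add: ell1_def)
    show ?thesis
      by (intro summable_comparison_test'[OF s, of 0])
        (simp add: norm_mult norm_power mult_left_mono z)
  qed
  note s = summable_norm_cancel[OF ns]
  have d: "(\<Sum>n. delta m n * z ^ n) = z ^ m" for m
    using suminf_finite[of "{m}" "\<lambda>n. delta m n * z ^ n"] by (auto simp: delta_def)
  show d1: "\<phi> (delta 1) = z"
    using d[of 1] by (simp add: \<phi>_def delta_in_ell1)
  show "max_ideal_at \<omega> z = {f \<in> carrier (ell1 \<omega>). \<phi> f = 0}"
    by (auto simp: max_ideal_at_def \<phi>_def)
  interpret cring "ell1 \<omega>" by (rule cring_ell1[OF w])
  have 1: "\<phi> (f \<oplus>\<^bsub>ell1 \<omega>\<^esub> g) = \<phi> f + \<phi> g"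
    if f: "f \<in> carrier (ell1 \<omega>)" and g: "g \<in> carrier (ell1 \<omega>)" for f g
  proof -
    have "(f \<oplus>\<^bsub>ell1 \<omega>\<^esub> g) = (\<lambda>n. f n + g n)" by (simp add: ell1_def)
    then show ?thesis
      using a_closed[OF f g] f g suminf_add[OF s[OF f] s[OF g]]
      by (simp add: \<phi>_def distrib_right)
  qed
  have 2: "\<phi> (\<lambda>n. c * f n) = c * \<phi> f" if f: "f \<in> carrier (ell1 \<omega>)" for c f
  proof -
    have "(\<lambda>n. c * f n) \<in> carrier (ell1 \<omega>)"
      using f summable_mult[of "\<lambda>n. cmod (f n) * \<omega> n" "cmod c"]
      by (simp add: ell1_def norm_mult mult_ac)
    then show ?thesis
      using f suminf_mult[OF s[OF f], of c] by (simp add: \<phi>_def mult.assoc)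
  qed
  have 3: "\<phi> (f \<otimes>\<^bsub>ell1 \<omega>\<^esub> g) = \<phi> f * \<phi> g"
    if f: "f \<in> carrier (ell1 \<omega>)" and g: "g \<in> carrier (ell1 \<omega>)" for f g
  proof -
    have "conv f g n * z ^ n = (\<Sum>k\<le>n. (f k * z ^ k) * (g (n - k) * z ^ (n - k)))" for n
      unfolding conv_def sum_distrib_right
      by (intro sum.cong refl) (simp add: power_add[symmetric] mult_ac)
    moreover have "f \<otimes>\<^bsub>ell1 \<omega>\<^esub> g = conv f g" by (simp add: ell1_def)
    ultimately show ?thesis
      using m_closed[OF f g] f g Cauchy_product[OF ns[OF f] ns[OF g]]
      by (simp add: \<phi>_def)
  qed
  have 4: "\<phi> (delta 0) \<noteq> 0" using d[of 0] by (simp add: \<phi>_def delta_in_ell1)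
  have "\<phi> \<in> extensional (carrier (ell1 \<omega>))" by (simp add: \<phi>_def)
  then show "\<phi> \<in> character_space \<omega>"
    unfolding character_space_def
    by (intro CollectI conjI ballI allI bexI[of _ "delta 0"] 1 2 3 4 delta_in_ell1) assumption+
qed

end

theory Submission
  imports Defs
begin

text \<open>
  Fix \<open>t \<in> [0,1]\<close>. Every \<open>x\<close> in the ideal \<open>M\<^sub>t\<close> is, as a formal power series, a multiple
  \<open>(X - t) y\<close>, where \<open>y n\<close> is the tail sum of \<open>x (n + 1 + i) t ^ i\<close> over all \<open>i\<close>. The question is how
  large \<open>y\<close> may be. Call \<open>N\<close> a drop of size \<open>\<delta>\<close> if \<open>\<omega> (N + 1) \<le> \<delta> \<omega> N\<close> and \<open>\<omega>\<close> is
  never below \<open>\<omega> (N + 1)\<close> after \<open>N\<close>.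

  If \<open>f\<close> is the sum of finitely many products \<open>a\<^sub>i x\<^sub>i\<close> with \<open>x\<^sub>i \<in> M\<^sub>t\<close>, its quotient by
  \<open>X - t\<close> is the sum of the \<open>a\<^sub>i y\<^sub>i\<close>. At a drop, \<open>\<omega> (N + 1)\<close> times the modulus of this
  quotient at \<open>N\<close> is at most \<open>\<eta>\<close> times the sum of the norms of the \<open>a\<^sub>i\<close>, where \<open>\<eta>\<close> tends to
  \<open>0\<close> with the size of the drop and depends only on the \<open>x\<^sub>i\<close> (lemma \<open>conv_quotient_small_at_drop\<close>).
  On the other hand, an element of \<open>M\<^sub>t\<close> can be written down whose quotient is much larger
  than this at infinitely many drops (lemma \<open>ideal_element_large_quotient\<close>). So no finite
  subset of \<open>M\<^sub>t\<close> generates it, provided that there are drops of arbitrarily small size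
  arbitrarily far out. This is a quantitative replacement for the usual argument
  through the open mapping theorem, and it treats \<open>t = 0\<close> and \<open>t = 1\<close> at once.

  For the weight in question, \<open>\<omega>\<close> can only decrease from \<open>n\<close> to \<open>n + 1\<close> when \<open>n\<close> is some \<open>n\<^sub>k\<close>, and
  there it falls by a factor of order \<open>1 / n\<^sub>k\<close>. Since \<open>\<omega>\<close> tends to infinity, it has a least value
  beyond each \<open>n\<^sub>k\<close>. The step down to that value happens at some \<open>n\<^sub>l\<close> with
  \<open>l \<ge> k\<close>, which is a drop of the required kind.
\<close>

section \<open>Division by \<open>X - t\<close>\<close>

lemma weight_ge_1: "weight \<omega> \<Longrightarrow> 1 \<le> \<omega> n"
  and weight_submult: "weight \<omega> \<Longrightarrow> \<omega> (m + n) \<le> \<omega> m * \<omega> n"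
  by (simp_all add: weight_def)

lemma weight_nonneg: "weight \<omega> \<Longrightarrow> 0 \<le> \<omega> n"
  using weight_ge_1[of \<omega> n] by linarith

definition quotient_at :: "real \<Rightarrow> (nat \<Rightarrow> complex) \<Rightarrow> nat \<Rightarrow> complex" where
  "quotient_at t f n = (\<Sum>i. f (n + 1 + i) * of_real t ^ i)"

lemma
  assumes w: "weight \<omega>" and f: "f \<in> carrier (ell1 \<omega>)"
  shows ell1_summable_norm: "summable (\<lambda>n. cmod (f n) * \<omega> n)"
    and ell1_summable_power: "0 \<le> t \<Longrightarrow> t \<le> 1 \<Longrightarrow> summable (\<lambda>i. cmod (f (n + i) * of_real t ^ i))"
proof -
  show s: "summable (\<lambda>n. cmod (f n) * \<omega> n)"
    using f by (simp add: ell1_def)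
  assume t: "0 \<le> t" "t \<le> 1"
  show "summable (\<lambda>i. cmod (f (n + i) * of_real t ^ i))"
  proof (rule summable_comparison_test'[OF summable_ignore_initial_segment[OF s, of n], of 0])
    fix i
    have "t ^ i \<le> \<omega> (n + i)"
      using power_le_one[OF t, of i] weight_ge_1[OF w, of "n + i"] by linarith
    then show "norm (cmod (f (n + i) * of_real t ^ i)) \<le> cmod (f (i + n)) * \<omega> (i + n)"
      using t by (simp add: norm_mult norm_power mult_left_mono add.commute)
  qed
qed

text \<open>Positive coefficients agree because consecutive tail sums differ by one term. The constant
  coefficient is where \<open>f\<close> has to vanish at \<open>t\<close>: the whole series is \<open>f 0\<close> plus \<open>t\<close> times the first
  tail.\<close>

lemma max_ideal_at_eq_mult_quotient:
  assumes w: "weight \<omega>" and t: "0 \<le> t" "t \<le> 1" and f: "f \<in> max_ideal_at \<omega> (of_real t)"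
  shows "Abs_fps f = (fps_X - fps_const (of_real t)) * Abs_fps (quotient_at t f)"
proof -
  let ?t = "complex_of_real t"
  have fc: "f \<in> carrier (ell1 \<omega>)" and f0: "(\<Sum>n. f n * ?t ^ n) = 0"
    using f by (auto simp: max_ideal_at_def)
  note s = summable_norm_cancel[OF ell1_summable_power[OF w fc t]]
  have split: "(\<Sum>i. f (n + i) * ?t ^ i) = f n + ?t * quotient_at t f n" for n
  proof -
    have "(\<Sum>i. f (n + Suc i) * ?t ^ Suc i) = (\<Sum>i. ?t * (f (n + 1 + i) * ?t ^ i))"
      by (simp add: mult_ac)
    also have "\<dots> = ?t * quotient_at t f n"
      unfolding quotient_at_def by (rule suminf_mult[OF s])
    finally show ?thesis
      using suminf_split_head[OF s[of n]] by simp
  qed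
  show ?thesis
  proof (rule fps_ext)
    fix n
    show "fps_nth (Abs_fps f) n
        = fps_nth ((fps_X - fps_const ?t) * Abs_fps (quotient_at t f)) n"
    proof (cases n)
      case 0
      have "f 0 = - (?t * quotient_at t f 0)"
        using split[of 0] f0 by (simp add: eq_neg_iff_add_eq_0)
      then show ?thesis using 0 by (simp add: left_diff_distrib)
    next
      case (Suc m)
      have "quotient_at t f m = f n + ?t * quotient_at t f n"
        using split[of n] Suc by (simp add: quotient_at_def)
      then show ?thesis using Suc by (simp add: left_diff_distrib)
    qed
  qed
qed

lemma finsum_ell1:
  assumes w: "weight \<omega>" and fin: "finite I"
    and a: "a \<in> I \<rightarrow> carrier (ell1 \<omega>)" and x: "x \<in> I \<rightarrow> carrier (ell1 \<omega>)"
  shows "(\<Oplus>\<^bsub>ell1 \<omega>\<^esub>i\<in>I. a i \<otimes>\<^bsub>ell1 \<omega>\<^esub> x i) = (\<lambda>n. \<Sum>i\<in>I. conv (a i) (x i) n)"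
proof -
  interpret cring "ell1 \<omega>" by (rule cring_ell1[OF w])
  show ?thesis
    using fin a x
  proof (induction I)
    case empty
    show ?case by (simp only: finsum_empty) (simp add: ell1_def)
  next
    case (insert i I)
    have "(\<Oplus>\<^bsub>ell1 \<omega>\<^esub>j\<in>insert i I. a j \<otimes>\<^bsub>ell1 \<omega>\<^esub> x j)
        = a i \<otimes>\<^bsub>ell1 \<omega>\<^esub> x i \<oplus>\<^bsub>ell1 \<omega>\<^esub> (\<Oplus>\<^bsub>ell1 \<omega>\<^esub>j\<in>I. a j \<otimes>\<^bsub>ell1 \<omega>\<^esub> x j)"
      using insert.prems insert.hyps by (intro finsum_insert) (auto intro!: m_closed)
    also have "\<dots> = a i \<otimes>\<^bsub>ell1 \<omega>\<^esub> x i \<oplus>\<^bsub>ell1 \<omega>\<^esub> (\<lambda>n. \<Sum>j\<in>I. conv (a j) (x j) n)"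
      using insert by auto
    finally show ?case
      using insert.hyps by (simp add: ell1_def)
  qed
qed

text \<open>Power series over a field have no zero divisors, so the factor \<open>X - t\<close> can be cancelled from
  an identity between elements of \<open>M\<^sub>t\<close>.\<close>

lemma quotient_of_combination:
  assumes w: "weight \<omega>" and t: "0 \<le> t" "t \<le> 1"
    and x: "\<And>i. i \<in> I \<Longrightarrow> x i \<in> max_ideal_at \<omega> (of_real t)"
    and f: "f \<in> max_ideal_at \<omega> (of_real t)"
    and eq: "f = (\<lambda>n. \<Sum>i\<in>I. conv (a i) (x i) n)"
  shows "quotient_at t f n = (\<Sum>i\<in>I. conv (a i) (quotient_at t (x i)) n)"
proof -
  let ?D = "fps_X - fps_const (complex_of_real t)"
  have "fps_nth ?D 1 = 1" by simp
  then have D: "?D \<noteq> 0" by (metis fps_zero_nth zero_neq_one)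
  have "?D * Abs_fps (quotient_at t f) = Abs_fps f"
    using max_ideal_at_eq_mult_quotient[OF w t f] by simp
  also have "\<dots> = (\<Sum>i\<in>I. Abs_fps (a i) * Abs_fps (x i))"
    unfolding eq by (rule fps_ext) (simp add: conv_eq_fps_mult fps_sum_nth)
  also have "\<dots> = (\<Sum>i\<in>I. ?D * (Abs_fps (a i) * Abs_fps (quotient_at t (x i))))"
    using max_ideal_at_eq_mult_quotient[OF w t x] by (intro sum.cong) (simp_all add: mult_ac)
  also have "\<dots> = ?D * (\<Sum>i\<in>I. Abs_fps (a i) * Abs_fps (quotient_at t (x i)))"
    by (rule sum_distrib_left[symmetric])
  finally have "Abs_fps (quotient_at t f)
      = (\<Sum>i\<in>I. Abs_fps (a i) * Abs_fps (quotient_at t (x i)))"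
    using D by simp
  then have "fps_nth (Abs_fps (quotient_at t f)) n
      = fps_nth (\<Sum>i\<in>I. Abs_fps (a i) * Abs_fps (quotient_at t (x i))) n"
    by simp
  then show ?thesis by (simp add: conv_eq_fps_mult fps_sum_nth)
qed

section \<open>Quotients at drops of the weight\<close>

text \<open>Minimality of \<open>\<omega> (N + 1)\<close> beyond \<open>N\<close> is what controls the tail sums in the
  quotient: a weight need not be monotone, so \<open>\<omega>\<close> at the start of a tail cannot in general be
  compared with its values along the tail.\<close>

definition drop_at :: "(nat \<Rightarrow> real) \<Rightarrow> real \<Rightarrow> nat \<Rightarrow> bool" where
  "drop_at \<omega> \<delta> N \<longleftrightarrow> \<omega> (N + 1) \<le> \<delta> * \<omega> N \<and> (\<forall>j>N. \<omega> (N + 1) \<le> \<omega> j)"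

text \<open>Split the convolution of \<open>a\<close> with the quotient \<open>y\<close> of \<open>x\<close> at an index \<open>J\<close> chosen so that the
  tail of \<open>x\<close> beyond \<open>J\<close> is small. The terms \<open>y j\<close> with \<open>j < J\<close>
  are finitely many and gain the factor \<open>\<delta>\<close>, as \<open>\<omega> (N + 1) \<le> \<delta> \<omega> (N - j) \<omega> j\<close>. For
  \<open>j \<ge> J\<close>, every \<open>i > j\<close> satisfies \<open>\<omega> (N + 1) \<le> \<omega> (N - j + i) \<le> \<omega> (N - j) \<omega> i\<close>, so that
  \<open>\<omega> (N + 1) y j\<close> is at most \<open>\<omega> (N - j)\<close> times the tail of the norm of \<open>x\<close>.\<close>

lemma conv_quotient_small_at_drop:
  assumes w: "weight \<omega>" and t: "0 \<le> t" "t \<le> 1" and x: "x \<in> carrier (ell1 \<omega>)" and \<eta>: "0 < \<eta>"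
  shows "\<forall>\<^sub>F \<delta> in at_right 0. \<forall>N. drop_at \<omega> \<delta> N \<longrightarrow> (\<forall>a \<in> carrier (ell1 \<omega>).
           cmod (conv a (quotient_at t x) N) * \<omega> (N + 1) \<le> \<eta> * (\<Sum>n. cmod (a n) * \<omega> n))"
proof -
  note p = weight_nonneg[OF w]
  define y where "y = quotient_at t x"
  note sx = ell1_summable_norm[OF w x]
  obtain J where J: "\<And>n. n \<ge> J \<Longrightarrow> norm (\<Sum>i. cmod (x (i + n)) * \<omega> (i + n)) < \<eta>"
    using suminf_exist_split[OF \<eta> sx] by blast
  define C where "C = (\<Sum>j<J. cmod (y j) * \<omega> j)"
  have C: "0 \<le> C" unfolding C_def by (intro sum_nonneg) (simp add: p)
  have "\<forall>\<^sub>F \<delta> in at_right 0. \<delta> * C \<le> \<eta>"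
    unfolding eventually_at_right_field
  proof (intro exI[of _ "\<eta> / (C + 1)"] conjI allI impI)
    show "0 < \<eta> / (C + 1)" using \<eta> C by simp
    fix \<delta> assume d: "0 < \<delta>" "\<delta> < \<eta> / (C + 1)"
    then have "\<delta> * (C + 1) < \<eta>" using C by (simp add: pos_less_divide_eq)
    then show "\<delta> * C \<le> \<eta>" using d by (simp add: distrib_left)
  qed
  then show ?thesis
    unfolding y_def[symmetric]
  proof eventually_elim
    case (elim \<delta>)
    show ?case
    proof (intro allI impI ballI)
      fix N a assume N: "drop_at \<omega> \<delta> N" and a: "a \<in> carrier (ell1 \<omega>)"
      then have drop: "\<omega> (N + 1) \<le> \<delta> * \<omega> N" and least: "\<And>j. j > N \<Longrightarrow> \<omega> (N + 1) \<le> \<omega> j"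
        by (auto simp: drop_at_def)
      have \<delta>: "0 \<le> \<delta>"
        using drop weight_ge_1[OF w, of "N + 1"] p[of N] mult_nonpos_nonneg[of \<delta> "\<omega> N"] by linarith
      have key: "cmod (y j) * \<omega> (N + 1) \<le> \<eta> * \<omega> (N - j)" if j: "j \<le> N" for j
      proof (cases "j < J")
        case True
        have "cmod (y j) * \<omega> j \<le> C"
          unfolding C_def using True by (intro member_le_sum) (auto simp: p)
        then have "\<delta> * (cmod (y j) * \<omega> j) \<le> \<delta> * C"
          by (rule mult_left_mono[OF _ \<delta>])
        with elim have le: "\<delta> * (cmod (y j) * \<omega> j) \<le> \<eta>" by simp
        have "\<omega> (N + 1) \<le> \<delta> * (\<omega> j * \<omega> (N - j))"
          using weight_submult[OF w, of j "N - j"] j by (intro order_trans[OF drop mult_left_mono[OF _ \<delta>]]) simp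
        then have "cmod (y j) * \<omega> (N + 1) \<le> cmod (y j) * (\<delta> * (\<omega> j * \<omega> (N - j)))"
          by (rule mult_left_mono) simp
        also have "\<dots> = (\<delta> * (cmod (y j) * \<omega> j)) * \<omega> (N - j)" by (simp add: mult_ac)
        also have "\<dots> \<le> \<eta> * \<omega> (N - j)" by (rule mult_right_mono[OF le p])
        finally show ?thesis .
      next
        case False
        let ?g = "\<lambda>i. cmod (x (j + 1 + i) * of_real t ^ i)"
        let ?h = "\<lambda>i. cmod (x (i + (j + 1))) * \<omega> (i + (j + 1))"
        note sg = ell1_summable_power[OF w x t, of "j + 1"]
        note sh = summable_ignore_initial_segment[OF sx, of "j + 1"]
        have "cmod (y j) * \<omega> (N + 1) \<le> (\<Sum>i. ?g i) * \<omega> (N + 1)"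
          unfolding y_def quotient_at_def
          by (intro mult_right_mono p summable_norm sg)
        also have "\<dots> = (\<Sum>i. ?g i * \<omega> (N + 1))"
          by (rule suminf_mult2[OF sg])
        also have "\<dots> \<le> (\<Sum>i. ?h i * \<omega> (N - j))"
        proof (intro suminf_le summable_mult2 sg sh)
          fix i
          have "\<omega> (N + 1) \<le> \<omega> ((i + (j + 1)) + (N - j))" using j by (intro least) simp
          then have "\<omega> (N + 1) \<le> \<omega> (i + (j + 1)) * \<omega> (N - j)"
            using weight_submult[OF w] order_trans by blast
          moreover have "?g i \<le> cmod (x (i + (j + 1)))"
            using t power_le_one[OF t, of i]
            by (simp add: norm_mult norm_power mult_left_le add_ac)
          ultimately have "?g i * \<omega> (N + 1) \<le> cmod (x (i + (j + 1))) * (\<omega> (i + (j + 1)) * \<omega> (N - j))"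
            by (intro mult_mono) (simp_all add: p)
          then show "?g i * \<omega> (N + 1) \<le> ?h i * \<omega> (N - j)" by (simp add: mult_ac)
        qed
        also have "\<dots> = (\<Sum>i. ?h i) * \<omega> (N - j)"
          by (rule suminf_mult2[OF sh, symmetric])
        also have "\<dots> \<le> \<eta> * \<omega> (N - j)"
          using J[of "j + 1"] False by (intro mult_right_mono p) auto
        finally show ?thesis .
      qed
      have "cmod (conv a y N) * \<omega> (N + 1) \<le> (\<Sum>k\<le>N. cmod (a k) * cmod (y (N - k))) * \<omega> (N + 1)"
        unfolding conv_def by (intro mult_right_mono p sum_norm_le) (simp add: norm_mult)
      also have "\<dots> = (\<Sum>k\<le>N. cmod (a k) * (cmod (y (N - k)) * \<omega> (N + 1)))"
        by (simp add: sum_distrib_right mult.assoc)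
      also have "\<dots> \<le> (\<Sum>k\<le>N. cmod (a k) * (\<eta> * \<omega> k))"
      proof (intro sum_mono mult_left_mono)
        fix k assume "k \<in> {..N}"
        then show "cmod (y (N - k)) * \<omega> (N + 1) \<le> \<eta> * \<omega> k" using key[of "N - k"] by simp
      qed simp
      also have "\<dots> = \<eta> * (\<Sum>k\<le>N. cmod (a k) * \<omega> k)"
        by (simp add: sum_distrib_left mult_ac)
      also have "\<dots> \<le> \<eta> * (\<Sum>n. cmod (a n) * \<omega> n)"
        using \<eta> p by (intro mult_left_mono sum_le_suminf ell1_summable_norm[OF w a]) auto
      finally show "cmod (conv a y N) * \<omega> (N + 1) \<le> \<eta> * (\<Sum>n. cmod (a n) * \<omega> n)" .
    qed
  qed
qed

text \<open>The element sought has the nonnegative values \<open>c l / \<omega> (N l + 1)\<close> at the places \<open>N l + 1\<close>, and its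
  value at \<open>0\<close> is adjusted so that it lies in the ideal. As \<open>t \<ge> 0\<close>, there is no cancellation in
  the tail sums, so the quotient at \<open>N l\<close> is at least the single value at \<open>N l + 1\<close>.\<close>

lemma ideal_element_large_quotient:
  assumes w: "weight \<omega>" and t: "0 \<le> t" "t \<le> 1"
    and N: "strict_mono N" and c: "summable c" "\<And>l. 0 \<le> c l"
  obtains f where "f \<in> max_ideal_at \<omega> (of_real t)"
    and "\<And>l. c l \<le> cmod (quotient_at t f (N l)) * \<omega> (N l + 1)"
proof -
  note p = weight_nonneg[OF w]
  define P where "P = (\<lambda>l. N l + 1)"
  have P: "strict_mono P" using N by (simp add: P_def strict_mono_def)
  then have inj: "inj P" by (rule strict_mono_imp_inj_on)
  define h where "h n = (if n \<in> range P then c (inv_into UNIV P n) / \<omega> n else 0)" for n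
  have h_nonneg: "0 \<le> h n" for n by (simp add: h_def c p)
  have hP: "h (P l) = c l / \<omega> (P l)" for l by (simp add: h_def inv_f_f[OF inj])
  have \<omega>_ne: "\<omega> n \<noteq> 0" for n using weight_ge_1[OF w, of n] by simp
  have "summable (\<lambda>l. h (P l) * \<omega> (P l))" using c by (simp add: hP \<omega>_ne)
  then have "summable (\<lambda>n. h n * \<omega> n)"
    by (subst (asm) summable_mono_reindex[OF P]) (simp_all add: h_def)
  then have hc: "(\<lambda>n. of_real (h n)) \<in> carrier (ell1 \<omega>)"
    by (simp add: ell1_def h_nonneg)
  define S where "S = (\<Sum>n. complex_of_real (h n) * of_real t ^ n)"
  define f where "f n = complex_of_real (h n) - S * delta 0 n" for n
  have s: "summable (\<lambda>n. complex_of_real (h n) * of_real t ^ n)"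
    using summable_norm_cancel[OF ell1_summable_power[OF w hc t, of 0]] by simp
  have d: "(\<lambda>n. S * delta 0 n * complex_of_real t ^ n) sums S"
    using sums_single[of 0 "\<lambda>_. S"] by (rule sums_cong[THEN iffD1, rotated]) (simp add: delta_def)
  have "(\<lambda>n. f n * of_real t ^ n) sums (S - S)"
    using sums_diff[OF summable_sums[OF s] d] by (simp add: S_def f_def left_diff_distrib)
  then have f0: "(\<Sum>n. f n * of_real t ^ n) = 0" by (simp add: sums_iff)
  have f_eq: "f n = of_real (h n)" if "n \<noteq> 0" for n
    using that by (simp add: f_def delta_def)
  have "summable (\<lambda>n. cmod (f (n + 1)) * \<omega> (n + 1))"
    using summable_ignore_initial_segment[OF ell1_summable_norm[OF w hc], of 1] by (simp add: f_eq)
  then have "summable (\<lambda>n. cmod (f n) * \<omega> n)"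
    by (subst (asm) summable_iff_shift)
  then have f: "f \<in> max_ideal_at \<omega> (of_real t)"
    using f0 by (simp add: max_ideal_at_def ell1_def)
  have "c l \<le> cmod (quotient_at t f (N l)) * \<omega> (N l + 1)" for l
  proof -
    let ?g = "\<lambda>i. h (N l + 1 + i) * t ^ i"
    have sg: "summable ?g"
      using ell1_summable_power[OF w hc t, of "N l + 1"] t
      by (simp add: norm_mult norm_power h_nonneg)
    have "quotient_at t f (N l) = of_real (\<Sum>i. ?g i)"
      unfolding quotient_at_def suminf_of_real[OF sg] by (simp add: f_eq)
    then have "(\<Sum>i. ?g i) \<le> cmod (quotient_at t f (N l))" by simp
    moreover have "?g 0 \<le> (\<Sum>i. ?g i)"
      using sum_le_suminf[OF sg, of "{0}"] t by (simp add: h_nonneg)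
    ultimately have "c l / \<omega> (P l) \<le> cmod (quotient_at t f (N l))"
      using hP[of l] by (simp add: P_def)
    then have "c l / \<omega> (P l) * \<omega> (P l) \<le> cmod (quotient_at t f (N l)) * \<omega> (P l)"
      by (rule mult_right_mono[OF _ p])
    then show ?thesis by (simp add: \<omega>_ne P_def)
  qed
  with f show thesis by (rule that)
qed

section \<open>Ideals that are not finitely generated\<close>

text \<open>Choose the drops \<open>N l\<close> so small that combinations of the generators have quotients of order
  \<open>(1/4) ^ l\<close> there, and compare with an element of the ideal whose quotient has order
  \<open>(1/2) ^ l\<close>.\<close>

theorem max_ideal_at_not_finitely_generated:
  assumes w: "weight \<omega>" and t: "0 \<le> t" "t \<le> 1"
    and drops: "\<And>\<delta> M. 0 < \<delta> \<Longrightarrow> \<exists>N\<ge>M. drop_at \<omega> \<delta> N"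
  shows "\<not> finitely_generated (ell1 \<omega>) (max_ideal_at \<omega> (of_real t))"
proof
  assume "finitely_generated (ell1 \<omega>) (max_ideal_at \<omega> (of_real t))"
  then obtain m :: nat and x where x: "x \<in> {1..m} \<rightarrow> carrier (ell1 \<omega>)"
    and gen: "max_ideal_at \<omega> (of_real t)
      = {(\<Oplus>\<^bsub>ell1 \<omega>\<^esub>i\<in>{1..m}. a i \<otimes>\<^bsub>ell1 \<omega>\<^esub> x i) | a. a \<in> {1..m} \<rightarrow> carrier (ell1 \<omega>)}"
    unfolding finitely_generated_def by blast
  have comb: "f \<in> max_ideal_at \<omega> (of_real t) \<longleftrightarrow>
      (\<exists>a \<in> {1..m} \<rightarrow> carrier (ell1 \<omega>). f = (\<lambda>n. \<Sum>i\<in>{1..m}. conv (a i) (x i) n))" for f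
    unfolding gen mem_Collect_eq Bex_def
  proof (rule iff_exI)
    fix a
    show "(f = (\<Oplus>\<^bsub>ell1 \<omega>\<^esub>i\<in>{1..m}. a i \<otimes>\<^bsub>ell1 \<omega>\<^esub> x i) \<and> a \<in> {1..m} \<rightarrow> carrier (ell1 \<omega>)) \<longleftrightarrow>
        (a \<in> {1..m} \<rightarrow> carrier (ell1 \<omega>) \<and> f = (\<lambda>n. \<Sum>i\<in>{1..m}. conv (a i) (x i) n))"
      using finsum_ell1[OF w finite_atLeastAtMost _ x, of a] by metis
  qed
  have xM: "x i \<in> max_ideal_at \<omega> (of_real t)" if i: "i \<in> {1..m}" for i
  proof -
    define a where "a j = (if j = i then delta 0 else (\<lambda>n. 0))" for j
    have "a j \<in> carrier (ell1 \<omega>)" for j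
      using delta_in_ell1[of 0 \<omega>] by (auto simp: a_def ell1_def)
    moreover have "Abs_fps (delta 0) = 1" by (auto simp: fps_eq_iff delta_def)
    then have "conv (a j) (x j) n = (if j = i then x i n else 0)" for j n
      by (simp add: a_def conv_eq_fps_mult fps_zero_def[symmetric])
    then have "x i = (\<lambda>n. \<Sum>j\<in>{1..m}. conv (a j) (x j) n)"
      using i by (simp add: fun_eq_iff)
    ultimately show ?thesis unfolding comb by blast
  qed
  define small where "small \<eta> N \<longleftrightarrow> (\<forall>i\<in>{1..m}. \<forall>a \<in> carrier (ell1 \<omega>).
      cmod (conv a (quotient_at t (x i)) N) * \<omega> (N + 1) \<le> \<eta> * (\<Sum>n. cmod (a n) * \<omega> n))" for \<eta> N
  have ex: "\<exists>N\<ge>M. small \<eta> N" if \<eta>: "0 < \<eta>" for \<eta> M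
  proof -
    have "\<forall>\<^sub>F \<delta> in at_right 0. \<forall>i\<in>{1..m}. \<forall>N. drop_at \<omega> \<delta> N \<longrightarrow> (\<forall>a \<in> carrier (ell1 \<omega>).
        cmod (conv a (quotient_at t (x i)) N) * \<omega> (N + 1) \<le> \<eta> * (\<Sum>n. cmod (a n) * \<omega> n))"
      using x \<eta> by (intro eventually_ball_finite ballI conv_quotient_small_at_drop[OF w t]) auto
    then have "\<forall>\<^sub>F \<delta> in at_right 0. 0 < \<delta> \<and> (\<forall>N. drop_at \<omega> \<delta> N \<longrightarrow> small \<eta> N)"
      using eventually_at_right_less by eventually_elim (auto simp: small_def)
    then obtain \<delta> where "0 < \<delta>" "\<And>N. drop_at \<omega> \<delta> N \<Longrightarrow> small \<eta> N"
      using eventually_happens'[OF trivial_limit_at_right_real] by blast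
    then show ?thesis using drops[of \<delta> M] by blast
  qed
  have "\<exists>N. \<forall>l. small ((1/4) ^ l) (N l) \<and> N l < N (Suc l)"
  proof (rule dependent_nat_choice)
    show "\<exists>n. small ((1/4) ^ 0) n" using ex[of "(1/4) ^ 0"] by auto
    fix n l show "\<exists>n'. small ((1/4) ^ Suc l) n' \<and> n < n'"
      using ex[of "(1/4) ^ Suc l" "Suc n"] by (auto simp: Suc_le_eq)
  qed
  then obtain N where N: "\<And>l. small ((1/4) ^ l) (N l)" "strict_mono N"
    by (auto simp: strict_mono_Suc_iff)
  obtain f where f: "f \<in> max_ideal_at \<omega> (of_real t)"
    and large: "\<And>l. (1/2) ^ l \<le> cmod (quotient_at t f (N l)) * \<omega> (N l + 1)"
    using ideal_element_large_quotient[OF w t N(2), of "\<lambda>l. (1/2) ^ l"] summable_geometric by auto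
  obtain a where a: "a \<in> {1..m} \<rightarrow> carrier (ell1 \<omega>)"
    and fa: "f = (\<lambda>n. \<Sum>i\<in>{1..m}. conv (a i) (x i) n)"
    using f unfolding comb by blast
  have qf: "quotient_at t f n = (\<Sum>i\<in>{1..m}. conv (a i) (quotient_at t (x i)) n)" for n
    using w t xM f fa by (rule quotient_of_combination)
  define K where "K = (\<Sum>i\<in>{1..m}. \<Sum>n. cmod (a i n) * \<omega> n)"
  have bound: "2 ^ l \<le> K" for l
  proof -
    have "(1/2) ^ l \<le> cmod (quotient_at t f (N l)) * \<omega> (N l + 1)" by (rule large)
    also have "\<dots> \<le> (\<Sum>i\<in>{1..m}. cmod (conv (a i) (quotient_at t (x i)) (N l))) * \<omega> (N l + 1)"
      unfolding qf by (intro mult_right_mono weight_nonneg[OF w] norm_sum)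
    also have "\<dots> \<le> (\<Sum>i\<in>{1..m}. (1/4) ^ l * (\<Sum>n. cmod (a i n) * \<omega> n))"
      unfolding sum_distrib_right using N(1)[of l] a
      by (intro sum_mono) (simp add: small_def Pi_iff)
    also have "\<dots> = (1/4) ^ l * K" by (simp add: K_def sum_distrib_left)
    finally have "4 ^ l * (1/2) ^ l \<le> 4 ^ l * ((1/4) ^ l * K)"
      by (rule mult_left_mono) simp
    moreover have "(4::real) ^ l * (1/2) ^ l = 2 ^ l" "(4::real) ^ l * (1/4) ^ l = 1"
      by (simp_all flip: power_mult_distrib)
    ultimately show ?thesis by (simp only: mult.assoc[symmetric] mult_1_left)
  qed
  obtain l where "K < 2 ^ l" using real_arch_pow[of 2 K] by auto
  with bound[of l] show False by simp
qed

section \<open>The weights with steps\<close>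

text \<open>Splitting \<open>(\<rho> + \<epsilon> (m + n)) ^ (m + n)\<close> into an \<open>m\<close>-th and an \<open>n\<close>-th power, the base only grows when
  \<open>m + n\<close> is replaced by \<open>m\<close> or by \<open>n\<close>.\<close>

lemma decreasing_base_weight:
  assumes "1 \<le> \<rho>" and pos: "\<And>n. 0 < \<epsilon> n" and dec: "\<And>n. \<epsilon> (Suc n) \<le> \<epsilon> n"
  shows "weight (\<lambda>n. (\<rho> + \<epsilon> n) ^ n)"
proof -
  have ge: "1 \<le> \<rho> + \<epsilon> n" for n using assms(1) pos[of n] by linarith
  have le: "(\<rho> + \<epsilon> (m + n)) ^ k \<le> (\<rho> + \<epsilon> m) ^ k" for m n k
    using lift_Suc_antimono_le[of \<epsilon>, OF dec, of m "m + n"] ge[of "m + n"]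
    by (intro power_mono) auto
  have "(\<rho> + \<epsilon> (m + n)) ^ (m + n) \<le> (\<rho> + \<epsilon> m) ^ m * (\<rho> + \<epsilon> n) ^ n" for m n
    unfolding power_add using le[of m n m] le[of n m n] ge[of m] ge[of "m + n"]
    by (intro mult_mono) (simp_all add: add.commute[of n m])
  then show ?thesis using ge by (simp add: weight_def one_le_power)
qed

lemma step_function_eq:
  fixes nk :: "nat \<Rightarrow> nat" and \<epsilon> :: "nat \<Rightarrow> real"
  assumes mono: "strict_mono_on {1..} nk"
    and first: "\<forall>n\<le>nk 1. \<epsilon> n = 1"
    and const: "\<And>k n. 2 \<le> k \<Longrightarrow> nk (k - 1) + 1 < n \<Longrightarrow> n \<le> nk k \<Longrightarrow> \<epsilon> n = \<epsilon> (nk (k - 1) + 1)"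
    and unbounded: "\<And>n. \<exists>k\<ge>1. n < nk k"
    and n: "n \<notin> nk ` {1..}"
  shows "\<epsilon> (Suc n) = \<epsilon> n"
proof -
  define k where "k = (LEAST k. 1 \<le> k \<and> n < nk k)"
  have k: "1 \<le> k" "n < nk k"
    using LeastI_ex[OF unbounded[of n, unfolded Bex_def]] unfolding k_def by auto
  show ?thesis
  proof (cases "k = 1")
    case True
    then show ?thesis using first k by simp
  next
    case False
    then have "\<not> (1 \<le> k - 1 \<and> n < nk (k - 1))"
      using not_less_Least[of "k - 1" "\<lambda>k. 1 \<le> k \<and> n < nk k"] k unfolding k_def[symmetric] by auto
    then have "nk (k - 1) \<le> n" using False k by auto
    moreover have "nk (k - 1) \<noteq> n" using n False k by auto
    ultimately have "nk (k - 1) + 1 \<le> n" by simp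
    have level: "\<epsilon> j = \<epsilon> (nk (k - 1) + 1)" if "nk (k - 1) + 1 \<le> j" "j \<le> nk k" for j
      using that const[of k j] False k by (cases "j = nk (k - 1) + 1") auto
    show ?thesis
      using level[of n] level[of "Suc n"] \<open>nk (k - 1) + 1 \<le> n\<close> k by simp
  qed
qed

text \<open>Beyond any index, a weight that tends to infinity attains its least value there at some \<open>N + 1\<close>,
  and \<open>N\<close> is either that index itself or a place where the weight does not increase.\<close>

lemma least_value_beyond:
  fixes \<omega> :: "nat \<Rightarrow> real"
  assumes "filterlim \<omega> at_top sequentially"
  obtains N where "N \<ge> M" and "\<And>j. j > M \<Longrightarrow> \<omega> (N + 1) \<le> \<omega> j"
proof -
  obtain B where B: "\<And>j. j \<ge> B \<Longrightarrow> \<omega> (M + 1) \<le> \<omega> j"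
    using assms unfolding filterlim_at_top eventually_sequentially by blast
  define I where "I = {M + 1..max B (M + 1)}"
  define p where "p = arg_min_on \<omega> I"
  have I: "finite I" "I \<noteq> {}" by (auto simp: I_def)
  have p: "p \<in> I" and le: "\<And>j. j \<in> I \<Longrightarrow> \<omega> p \<le> \<omega> j"
    unfolding p_def using arg_min_if_finite(1)[OF I] arg_min_least[OF I] by auto
  have "M + 1 \<in> I" by (simp add: I_def)
  then have "\<omega> p \<le> \<omega> j" if "j > M" for j
  proof (cases "j \<in> I")
    case False
    then have "\<omega> (M + 1) \<le> \<omega> j" using that by (intro B) (simp add: I_def)
    with le[OF \<open>M + 1 \<in> I\<close>] show ?thesis by (rule order_trans)
  qed (rule le)
  moreover have "p - 1 \<ge> M" "p - 1 + 1 = p" using p by (auto simp: I_def)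
  ultimately show thesis using that[of "p - 1"] by simp
qed

theorem theorem7p4:
  fixes \<rho> :: real and nk :: "nat \<Rightarrow> nat" and \<epsilon> :: "nat \<Rightarrow> real" and \<omega> :: "nat \<Rightarrow> real"
  assumes "\<rho> > 1"
    and "\<forall>k\<ge>1. nk k \<ge> 1"
    and "strict_mono_on {1..} nk"
    and "\<forall>n. \<epsilon> n > 0"
    and "\<forall>n\<le>nk 1. \<epsilon> n = 1"
    and "\<forall>k\<ge>2. (\<forall>n. nk (k - 1) + 1 < n \<and> n \<le> nk k \<longrightarrow> \<epsilon> n = \<epsilon> (nk (k - 1) + 1)) \<and>
           0 < (1 / real (nk k)) powr (1 / real (nk k)) * (\<rho> + \<epsilon> (nk (k - 1) + 1)) - \<rho>"
    and "\<forall>k\<ge>1. 0 < \<epsilon> (nk k + 1) \<and>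
           \<epsilon> (nk k + 1) < (1 / real (nk k)) powr (1 / real (nk k)) * (\<rho> + \<epsilon> (nk k)) - \<rho> \<and>
           \<epsilon> (nk k + 1) < min (1 / real k) (\<epsilon> (nk k))"
    and "\<forall>n. \<omega> n = (\<rho> + \<epsilon> n) ^ n"
  shows "weight \<omega> \<and>
    \<not> finitely_generated (ell1 \<omega>) (max_ideal_at \<omega> 1) \<and>
    \<not> finitely_generated (ell1 \<omega>) (max_ideal_at \<omega> 0) \<and>
    0 \<in> interior (character_disc \<omega>) \<and>
    1 \<in> interior (character_disc \<omega>)"
proof -
  note pos = assms(4)[rule_format] and \<omega> = assms(8)[rule_format]
  have nk_ge: "k \<le> nk k" if "1 \<le> k" for k
    using that
  proof (induction k rule: nat_induct_at_least)
    case base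
    then show ?case using assms(2) by simp
  next
    case (Suc k)
    then show ?case using strict_mono_onD[OF assms(3), of k "Suc k"] by auto
  qed
  have unbounded: "\<exists>k\<ge>1. n < nk k" for n
    using nk_ge[of "Suc n"] by (intro exI[of _ "Suc n"]) simp
  have const: "\<epsilon> (Suc n) = \<epsilon> n" if "n \<notin> nk ` {1..}" for n
    using step_function_eq[OF assms(3,5) _ unbounded that] assms(6) by blast
  have dec: "\<epsilon> (Suc n) \<le> \<epsilon> n" for n
    using const[of n] assms(7) by (cases "n \<in> nk ` {1..}") fastforce+
  have w: "weight \<omega>"
    using decreasing_base_weight[of \<rho> \<epsilon>] assms(1) pos dec \<omega> by (simp add: weight_def)
  have \<omega>_ge: "\<rho> ^ n \<le> \<omega> n" for n
    unfolding \<omega> using assms(1) pos[of n] by (intro power_mono) auto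
  have \<omega>_top: "filterlim \<omega> at_top sequentially"
  proof (rule filterlim_at_top_mono[OF _ always_eventually])
    show "LIM n sequentially. \<rho> ^ n :> at_top"
      using assms(1) filterlim_realpow_sequentially_gt1[of \<rho>]
      by (intro filterlim_at_infinity_imp_filterlim_at_top) auto
  qed (simp add: \<omega>_ge)
  have ratio: "\<omega> (nk k + 1) \<le> (\<rho> + 1) / nk k * \<omega> (nk k)" if k: "1 \<le> k" for k
  proof -
    let ?n = "nk k" and ?r = "(1 / real (nk k)) powr (1 / real (nk k))"
    have n: "0 < ?n" using assms(2)[rule_format, OF k] by simp
    have "\<epsilon> (?n + 1) < 1 / real k" using assms(7) k by simp
    also have "\<dots> \<le> 1" using k by simp
    finally have e1: "\<epsilon> (?n + 1) < 1" .
    \<comment> \<open>The upper bound on \<open>\<epsilon> (n\<^sub>k + 1)\<close> contains an \<open>n\<^sub>k\<close>-th root so that its \<open>n\<^sub>k\<close>-th power gains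
      exactly the factor \<open>1 / n\<^sub>k\<close>.\<close>
    have "\<rho> + \<epsilon> (?n + 1) \<le> ?r * (\<rho> + \<epsilon> ?n)" using assms(7) k by fastforce
    then have "(\<rho> + \<epsilon> (?n + 1)) ^ ?n \<le> (?r * (\<rho> + \<epsilon> ?n)) ^ ?n"
      using assms(1) pos[of "?n + 1"] by (intro power_mono) auto
    also have "\<dots> = ?r ^ ?n * \<omega> ?n" by (simp add: power_mult_distrib \<omega>)
    also have "?r ^ ?n = 1 / ?n"
      using n by (simp add: powr_realpow[symmetric] powr_powr)
    finally have "(\<rho> + \<epsilon> (?n + 1)) * (\<rho> + \<epsilon> (?n + 1)) ^ ?n \<le> (\<rho> + 1) * (1 / ?n * \<omega> ?n)"
      using assms(1) pos[of "?n + 1"] e1 by (intro mult_mono) auto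
    then show ?thesis by (simp add: \<omega>)
  qed
  have drops: "\<exists>N\<ge>M. drop_at \<omega> \<delta> N" if \<delta>: "0 < \<delta>" for \<delta> M
  proof -
    obtain k where k: "1 \<le> k" "max M (nat \<lceil>(\<rho> + 1) / \<delta>\<rceil>) < nk k"
      using unbounded by blast
    obtain N where N: "N \<ge> nk k" and least: "\<And>j. j > nk k \<Longrightarrow> \<omega> (N + 1) \<le> \<omega> j"
      using least_value_beyond[OF \<omega>_top] by blast
    \<comment> \<open>Otherwise \<open>\<omega>\<close> would grow from \<open>N\<close> to \<open>N + 1\<close>, and \<open>N + 1\<close> would not be a minimizer.\<close>
    have "N \<in> nk ` {1..}"
    proof (rule ccontr)
      assume *: "N \<notin> nk ` {1..}"
      then have "N \<noteq> nk k" using k by auto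
      then have "\<omega> (N + 1) \<le> \<omega> N" using N by (intro least) simp
      moreover have "\<omega> (N + 1) = (\<rho> + \<epsilon> N) * \<omega> N" using const[OF *] by (simp add: \<omega>)
      moreover have "1 * \<omega> N < (\<rho> + \<epsilon> N) * \<omega> N"
        using assms(1) pos[of N] weight_ge_1[OF w, of N] by (intro mult_strict_right_mono) auto
      ultimately show False by simp
    qed
    then obtain l where l: "1 \<le> l" "N = nk l" by auto
    have "(\<rho> + 1) / \<delta> \<le> N" using k N real_nat_ceiling_ge[of "(\<rho> + 1) / \<delta>"] by linarith
    moreover have "0 < N" using k N by simp
    ultimately have "(\<rho> + 1) / N \<le> \<delta>" using \<delta> by (simp add: field_simps)
    then have "(\<rho> + 1) / N * \<omega> N \<le> \<delta> * \<omega> N"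
      by (rule mult_right_mono[OF _ weight_nonneg[OF w]])
    then have "\<omega> (N + 1) \<le> \<delta> * \<omega> N"
      using ratio[OF l(1)] l(2) by simp
    then have "drop_at \<omega> \<delta> N" using least N by (simp add: drop_at_def)
    moreover have "N \<ge> M" using k N by simp
    ultimately show ?thesis by blast
  qed
  have disc: "ball 0 \<rho> \<subseteq> character_disc \<omega>"
  proof
    fix z :: complex assume "z \<in> ball 0 \<rho>"
    then have "cmod z ^ n \<le> \<omega> n" for n
      using \<omega>_ge[of n] power_mono[of "cmod z" \<rho> n] by simp
    note ev = evaluation_character(1,2)[OF w this]
    show "z \<in> character_disc \<omega>"
      unfolding character_disc_def by (rule image_eqI[OF _ ev(1)]) (rule ev(2)[symmetric])
  qed
  have "z \<in> interior (character_disc \<omega>)" if "cmod z < \<rho>" for z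
    using that by (intro interiorI[OF open_ball _ disc]) simp
  then show ?thesis
    using w assms(1) max_ideal_at_not_finitely_generated[OF w _ _ drops, of 0]
      max_ideal_at_not_finitely_generated[OF w _ _ drops, of 1] by simp
qed

end
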